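(* Let $n$ be an odd perfect number, written in the form $n=\pi^\alpha M^2$, where $\pi$ is prime, $\alpha$ and $M$ are positive integers, $\gcd(\pi,M)=1$ and $\pi\equiv\alpha\equiv 1\pmod 4$. Then $$\bigl(n\equiv 9\pmod{36}\bigr)\ \text{ or }\ \bigl(n\equiv \pi\equiv 1\pmod{12}\bigr).$$
   Context: A positive integer $n$ is perfect if $\sigma(n)=2n$, where $\sigma(n)$ is the sum of the positive divisors of $n$. By Euler's theorem every odd perfect number $n$ has such a representation $n=\pi^\alpha M^2$; $\pi$ is the unique prime dividing $n$ to an odd power and $\alpha$ is its exponent. The condition "$n\equiv\pi\equiv 1\pmod{12}$" means that both $n\equiv 1\pmod{12}$ and $\pi\equiv 1\pmod{12}$. *)

theory Defs
  imports "HOL-Number_Theory.Number_Theory"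
begin

definition divisor_sum :: "nat \<Rightarrow> nat" where
  "divisor_sum n = (\<Sum>d | d dvd n. d)"

text \<open>Positivity is needed: the divisors of \<open>0\<close> form an infinite set, over which the sum is \<open>0\<close>.\<close>

definition perfect :: "nat \<Rightarrow> bool" where
  "perfect n \<longleftrightarrow> n > 0 \<and> divisor_sum n = 2 * n"

end

theory Submission
  imports Defs
begin

text \<open>
  If \<open>n \<equiv> 2 (mod 3)\<close>, then complementary divisors \<open>d\<close> and \<open>n / d\<close> are \<open>1\<close> and \<open>2\<close> modulo \<open>3\<close>
  in some order, so \<open>3\<close> divides \<open>\<sigma>(n)\<close> and \<open>n\<close> is not perfect. Hence \<open>3\<close> divides \<open>n\<close>, and then
  it divides \<open>M\<close>, because \<open>\<pi> \<equiv> 1 (mod 4)\<close>; or else \<open>n \<equiv> 1 (mod 3)\<close>, which forces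
  \<open>\<pi> \<equiv> \<pi>\<^sup>\<alpha> \<equiv> n \<equiv> 1 (mod 3)\<close>, because \<open>\<alpha>\<close> is odd. Finally, \<open>n \<equiv> 1 (mod 4)\<close>.
\<close>

lemma three_dvd_divisor_sum:
  fixes n :: nat
  assumes "n mod 3 = 2"
  shows "3 dvd divisor_sum n"
proof -
  have "n > 0" using assms by (cases n) auto
  have pair: "3 dvd d + n div d" if "d dvd n" for d
  proof -
    obtain e where n: "n = d * e" using \<open>d dvd n\<close> by blast
    have "(d mod 3) * (e mod 3) mod 3 = 2"
      using assms n by (simp add: mod_mult_eq)
    moreover have "d mod 3 \<in> {0, 1, 2}" "e mod 3 \<in> {0, 1, 2}" by auto
    ultimately have "(d mod 3 + e mod 3) mod 3 = 0" by auto
    then have "3 dvd d + e" by (simp add: mod_add_eq mod_eq_0_iff_dvd)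
    then show ?thesis using n \<open>n > 0\<close> by simp
  qed
  \<comment> \<open>The involution \<open>n div d\<close> permutes the divisors. Summing
    \<open>d + n div d\<close> over all of them avoids choosing one divisor from each pair, at the
    cost of a factor 2, which is invertible modulo 3.\<close>
  have "(\<Sum>d | d dvd n. d) = (\<Sum>d | d dvd n. n div d)"
    by (rule sum.reindex_bij_witness[of _ "\<lambda>d. n div d" "\<lambda>d. n div d"])
       (use \<open>n > 0\<close> in \<open>auto elim!: dvdE\<close>)
  then have "2 * divisor_sum n = (\<Sum>d | d dvd n. d + n div d)"
    by (simp add: divisor_sum_def sum.distrib)
  also have "3 dvd \<dots>" by (rule dvd_sum) (use pair in auto)
  finally show ?thesis by presburger
qed

text \<open>For \<open>n mod 3 = 2\<close> the number \<open>2 * n\<close> is 1 modulo 3, so it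
  cannot equal a multiple of 3.\<close>

lemma perfect_mod_3_neq_2:
  assumes "perfect n"
  shows "n mod 3 \<noteq> 2"
  using three_dvd_divisor_sum[of n] assms unfolding perfect_def by presburger

lemma square_mod_3_eq_1:
  fixes m :: nat
  assumes "\<not> 3 dvd m"
  shows "m\<^sup>2 mod 3 = 1"
proof -
  have "m mod 3 = 1 \<or> m mod 3 = 2" using assms by presburger
  then have "(m mod 3)\<^sup>2 mod 3 = 1" by auto
  then show ?thesis by (simp add: power_mod)
qed

lemma odd_square_mod_4_eq_1:
  fixes m :: nat
  assumes "odd m"
  shows "m\<^sup>2 mod 4 = 1"
proof -
  have "m mod 4 = 1 \<or> m mod 4 = 3" using assms by presburger
  then have "(m mod 4)\<^sup>2 mod 4 = 1" by auto
  then show ?thesis by (simp add: power_mod)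
qed

text \<open>Since \<open>p\<^sup>2\<close> is 1 modulo 3, only the parity of the exponent
  matters.\<close>

lemma odd_power_mod_3:
  fixes p a :: nat
  assumes "odd a" and "\<not> 3 dvd p"
  shows "p ^ a mod 3 = p mod 3"
proof -
  obtain k where a: "a = 2 * k + 1" using \<open>odd a\<close> by (elim oddE)
  have "[p * (p\<^sup>2) ^ k = p * 1 ^ k] (mod 3)"
    by (intro cong_mult cong_pow cong_refl)
       (use square_mod_3_eq_1[OF \<open>\<not> 3 dvd p\<close>] in \<open>simp add: cong_def\<close>)
  then show ?thesis by (simp add: a cong_def power_mult)
qed

theorem theorem1:
  fixes n p \<alpha> M :: nat
  assumes "odd n" and "perfect n"
    and "n = p ^ \<alpha> * M ^ 2"
    and "prime p" and "\<alpha> > 0" and "M > 0"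
    and "coprime p M"
    and "[p = 1] (mod 4)" and "[\<alpha> = 1] (mod 4)"
  shows "[n = 9] (mod 36) \<or> ([n = 1] (mod 12) \<and> [p = 1] (mod 12))"
proof -
  have "odd M" using \<open>odd n\<close> \<open>n = p ^ \<alpha> * M ^ 2\<close> by simp
  then have "[p ^ \<alpha> * M\<^sup>2 = 1 ^ \<alpha> * 1] (mod 4)"
    by (intro cong_mult cong_pow \<open>[p = 1] (mod 4)\<close>)
       (use odd_square_mod_4_eq_1 in \<open>simp add: cong_def\<close>)
  then have n4: "n mod 4 = 1" using \<open>n = p ^ \<alpha> * M ^ 2\<close> by (simp add: cong_def)
  have p4: "p mod 4 = 1" using \<open>[p = 1] (mod 4)\<close> by (simp add: cong_def)
  have "odd \<alpha>" using \<open>[\<alpha> = 1] (mod 4)\<close> unfolding cong_def by presburger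
  have "p \<noteq> 3" using p4 by auto
  then have p3: "\<not> 3 dvd p"
    using \<open>prime p\<close> primes_dvd_imp_eq[of 3 p] by auto
  show ?thesis
  proof (cases "3 dvd M")
    case True
    then have "3\<^sup>2 dvd n"
      unfolding \<open>n = p ^ \<alpha> * M ^ 2\<close> by (intro dvd_mult dvd_power_same)
    \<comment> \<open>The residue 9 is 0 modulo 9 and 1 modulo 4, so it is the one that the Chinese
      remainder theorem selects modulo 36.\<close>
    then have "[n = 9] (mod 9)" by (simp add: cong_def mod_eq_0_iff_dvd)
    moreover have "[n = 9] (mod 4)" using n4 by (simp add: cong_def)
    moreover have "coprime (9::nat) 4"
      using coprime_power_left_iff[of "3::nat" 2 4] coprime_power_right_iff[of "3::nat" 2 2] by simp
    ultimately have "[n = 9] (mod 9 * 4)" by (rule coprime_cong_mult_nat)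
    then show ?thesis by simp
  next
    case False
    have "n mod 3 = (p ^ \<alpha> mod 3) * (M\<^sup>2 mod 3) mod 3"
      using \<open>n = p ^ \<alpha> * M ^ 2\<close> by (simp add: mod_mult_eq)
    also have "\<dots> = p mod 3"
      using odd_power_mod_3[OF \<open>odd \<alpha>\<close> p3] square_mod_3_eq_1[OF False] by simp
    finally have "n mod 3 = p mod 3" .
    \<comment> \<open>As \<open>p\<close> and \<open>n\<close> agree modulo 3, excluding the residue
      2 for \<open>n\<close> excludes it for \<open>p\<close> as well.\<close>
    moreover have "p mod 3 = 1 \<or> p mod 3 = 2" using p3 by presburger
    ultimately have "n mod 3 = 1" "p mod 3 = 1"
      using perfect_mod_3_neq_2[OF \<open>perfect n\<close>] by auto
    then have "[n = 1] (mod 3)" "[p = 1] (mod 3)" by (simp_all add: cong_def)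
    moreover have "[n = 1] (mod 4)" using n4 by (simp add: cong_def)
    moreover have "coprime (3::nat) 4"
      using coprime_power_right_iff[of "3::nat" 2 2] by simp
    ultimately have "[n = 1] (mod 3 * 4)" "[p = 1] (mod 3 * 4)"
      using \<open>[p = 1] (mod 4)\<close> by (blast intro: coprime_cong_mult_nat)+
    then show ?thesis by simp
  qed
qed

end
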